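(* Let $\mathcal{X}$ be a set of $n\times n$ matrices over $\mathbb{R}_{\max}$ satisfying the standing assumptions (A1)–(A3) listed in the context, let $A_1,\dots,A_k\in\mathcal{X}$, and let $\Gamma(k)=A_1\otimes A_2\otimes\cdots\otimes A_k$. Suppose that, for some $i,j\in\{1,\dots,n\}$, $$k>\max\left(\frac{w_i+v_j-\gamma_{ij}}{\lambda^*}+(n-1),\ \frac{w_i-\alpha_i+v_j-\beta_j}{\lambda^*}+2(n-1)\right).$$ Then, for this pair $i,j$, $$\Gamma(k)_{i,j}=\Gamma(k)_{i,1}\otimes\Gamma(k)_{1,j}=\Gamma(k)_{i,1}+\Gamma(k)_{1,j}.$$
   Context: Max-plus algebra: $\mathbb{R}_{\max}=\mathbb{R}\cup\{-\infty\}$, $a\oplus b=\max\{a,b\}$, $a\otimes b=a+b$; for matrices, $(A\otimes B)_{i,j}=\max_{k}(a_{i,k}+b_{k,j})$. Digraphs: for $A\in\mathbb{R}_{\max}^{n\times n}$, $\mathcal{D}_A$ is the weighted digraph with nodes $N=\{1,\dots,n\}$, edge set $E_A=\{(i,j): a_{i,j}\neq-\infty\}$, and edge weights $a_{i,j}$. A walk is a sequence of nodes $(i_0,\dots,i_l)$ with consecutive pairs being edges; its length is $l$ and its weight is the sum of the weights of its edges; $(i_0)$ is a walk of length $0$ and weight $0$. A path is a walk with no repeated nodes; a cycle is a walk with $i_0=i_l$. $A$ is irreducible if $\mathcal{D}_A$ is strongly connected. $A,B$ are geometrically equivalent if $E_A=E_B$. A critical cycle of $\mathcal{D}_A$ is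 an elementary cycle (no repeated node except start = end, length at least 1) whose mean weight (weight divided by length) is maximal among all cycles of $\mathcal{D}_A$. Matrix set: $\mathcal{X}$ is a nonempty (possibly infinite) set of matrices in $\mathbb{R}_{\max}^{n\times n}$; $A^{\sup}$ and $A^{\inf}$ are the entrywise supremum and infimum over $\mathcal{X}$. Standing assumptions: (A1) the matrices in $\mathcal{X}$ are irreducible and pairwise geometrically equivalent, and $A^{\inf}$ is geometrically equivalent to them; (A2) for each $X\in\mathcal{X}$, $\mathcal{D}_X$ has a unique critical cycle, namely the loop of length $1$ at node $1$, with weight $0$; (A3) $\mathcal{D}_{A^{\sup}}$ has a unique critical cycle, namely the loop of length $1$ at node $1$, with weight $0$. Parameters (maxima over empty sets are $-\infty$): $\lambda^*$ is the largest cycle mean in the submatrix $(A^{\sup}_{i,j})_{i,j\neq1}$, i.e. $\lambda^*=\max_{r\ge1}\max_{2\le i_1,\dots,i_r\le n}\frac{A^{\sup}_{i_1i_2}+\dots+A^{\sup}_{i_ri_1}}{r}$; $\alpha_i$ is the maximal weight of paths on $\mathcal{D}_{A^{\sup}}$ connecting $i$ to $1$; $\beta_j$ is the maximal weight of paths on $\mathcal{D}_{A^{\sup}}$ connecting $1$ to $j$; $\gamma_{ij}$ is the maximal weight of paths on $\mathcal{D}_{A^{\sup}}$ connecting $i$ to $j$ and not going through node $1$; $w_i$ is the maximal weight of walks of length not exceeding $k$ on $\mathcal{D}_{A^{\inf}}$ connecting $i$ to $1$; $v_j$ is the maximal weight of walks of length not exceeding $k$ on $\mathcal{D}_{A^{\inf}}$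 connecting $1$ to $j$. Conventions for degenerate values: if $\gamma_{ij}=-\infty$, the quotient containing $\gamma_{ij}$ is $-\infty$ (imposes no condition); otherwise, if $\lambda^*=-\infty$, quotients by $\lambda^*$ are $0$; otherwise a numerator equal to $-\infty$ gives a quotient $+\infty$ (since $\lambda^*<0$). *)

theory Defs
  imports
    "HOL-Analysis.Finite_Cartesian_Product"
    "HOL-Library.Extended_Real"
    "Graph_Theory.Arc_Walk"
    "Graph_Theory.Digraph_Component"
begin

text \<open>
  A matrix over \<open>\<real> \<union> {-\<infinity>}\<close> is an element of \<^typ>\<open>ereal^'n^'n\<close> without entries \<open>\<infinity>\<close>.
  On such values \<open>max\<close> and \<open>+\<close> of \<^typ>\<open>ereal\<close> are the max-plus operations.
  The type \<open>'n\<close> plays the role of \<open>{1, ..., n}\<close>, with \<open>n = CARD('n)\<close>;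
  as \<open>'n\<close> has no distinguished element, ``node 1'' is a parameter, called \<open>c\<close>.
\<close>

definition rmax_mat :: "ereal^'n^'n \<Rightarrow> bool" where
  "rmax_mat A \<longleftrightarrow> (\<forall>i j. A $ i $ j \<noteq> \<infinity>)"

definition mp_mult :: "ereal^'n^'n \<Rightarrow> ereal^'n^'n \<Rightarrow> ereal^('n::finite)^'n"  (infixl \<open>\<otimes>\<^sub>m\<close> 70)
  where "A \<otimes>\<^sub>m B = (\<chi> i j. MAX l. A $ i $ l + B $ l $ j)"

definition mp_one :: "ereal^'n^('n::finite)" where
  "mp_one = (\<chi> i j. if i = j then 0 else -\<infinity>)"

text \<open>\<open>mp_prod A k\<close> is \<open>A 1 \<otimes>\<^sub>m \<dots> \<otimes>\<^sub>m A k\<close>; the empty product is the max-plus identity.\<close>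

fun mp_prod :: "(nat \<Rightarrow> ereal^'n^'n) \<Rightarrow> nat \<Rightarrow> ereal^('n::finite)^'n" where
  "mp_prod A 0 = mp_one"
| "mp_prod A (Suc k) = mp_prod A k \<otimes>\<^sub>m A (Suc k)"

definition mat_sup :: "(ereal^'n^'n) set \<Rightarrow> ereal^('n::finite)^'n" where
  "mat_sup \<X> = (\<chi> i j. SUP X\<in>\<X>. X $ i $ j)"

definition mat_inf :: "(ereal^'n^'n) set \<Rightarrow> ereal^('n::finite)^'n" where
  "mat_inf \<X> = (\<chi> i j. INF X\<in>\<X>. X $ i $ j)"

definition edges :: "ereal^'n^'n \<Rightarrow> ('n \<times> 'n) set" where
  "edges A = {(i, j). A $ i $ j \<noteq> -\<infinity>}"

definition digraph_of :: "ereal^'n^'n \<Rightarrow> ('n, 'n \<times> 'n) pre_digraph" where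
  "digraph_of A = \<lparr>verts = UNIV, arcs = edges A, tail = fst, head = snd\<rparr>"

definition irreducible_mat :: "ereal^'n^'n \<Rightarrow> bool" where
  "irreducible_mat A \<longleftrightarrow> strongly_connected (digraph_of A)"

definition geom_equiv :: "ereal^'n^'n \<Rightarrow> ereal^'n^'n \<Rightarrow> bool" where
  "geom_equiv A B \<longleftrightarrow> edges A = edges B"

text \<open>
  Walks are the arc walks of \<open>Graph_Theory\<close>: a walk is given by its start node and its list of
  arcs, so its length is the length of that list, and \<open>[]\<close> is the walk of length 0 at any node.
  The weight takes values in \<^typ>\<open>ereal\<close>: an entry \<open>\<infinity>\<close> of a supremum matrix is an edge of
  weight \<open>\<infinity>\<close>.
\<close>

abbreviation walk :: "ereal^'n^'n \<Rightarrow> 'n \<Rightarrow> ('n \<times> 'n) list \<Rightarrow> 'n \<Rightarrow> bool" where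
  "walk A \<equiv> pre_digraph.awalk (digraph_of A)"

abbreviation simple_path :: "ereal^'n^'n \<Rightarrow> 'n \<Rightarrow> ('n \<times> 'n) list \<Rightarrow> 'n \<Rightarrow> bool" where
  "simple_path A \<equiv> pre_digraph.apath (digraph_of A)"

abbreviation walk_nodes :: "ereal^'n^'n \<Rightarrow> 'n \<Rightarrow> ('n \<times> 'n) list \<Rightarrow> 'n list" where
  "walk_nodes A \<equiv> pre_digraph.awalk_verts (digraph_of A)"

definition weight :: "ereal^'n^'n \<Rightarrow> ('n \<times> 'n) list \<Rightarrow> ereal" where
  "weight A p = (\<Sum>(i, j)\<leftarrow>p. A $ i $ j)"

definition mean_weight :: "ereal^'n^'n \<Rightarrow> ('n \<times> 'n) list \<Rightarrow> ereal" where
  "mean_weight A p = weight A p / ereal (real (length p))"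

text \<open>\<open>pre_digraph.cycle\<close> is the notion of a nonempty elementary cycle.\<close>

definition critical_cycle :: "ereal^'n^'n \<Rightarrow> ('n \<times> 'n) list \<Rightarrow> bool" where
  "critical_cycle A p \<longleftrightarrow> pre_digraph.cycle (digraph_of A) p \<and>
     (\<forall>u q. walk A u q u \<and> q \<noteq> [] \<longrightarrow> mean_weight A q \<le> mean_weight A p)"

text \<open>
  Rotations of a cycle are different arc lists, but a loop has only one rotation, so that
  uniqueness as a list and uniqueness as a cycle agree here.
\<close>

definition unique_critical_loop :: "'n \<Rightarrow> ereal^'n^'n \<Rightarrow> bool" where
  "unique_critical_loop c A \<longleftrightarrow> {p. critical_cycle A p} = {[(c, c)]} \<and> weight A [(c, c)] = 0"

text \<open>
  The parameters below take the supremum in \<^typ>\<open>ereal\<close>, so that maxima over empty sets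
  are \<open>-\<infinity>\<close>. In \<open>lambda_star\<close>, the list \<open>p\<close> is the closed node sequence
  \<open>i\<^sub>1, ..., i\<^sub>r, i\<^sub>1\<close>, written without its last element.
\<close>

definition lambda_star :: "'n \<Rightarrow> (ereal^'n^'n) set \<Rightarrow> ereal" where
  "lambda_star c \<X> = (SUP p\<in>{p. p \<noteq> [] \<and> c \<notin> set p}.
     (\<Sum>t<length p. mat_sup \<X> $ (p ! t) $ (p ! (Suc t mod length p))) / ereal (real (length p)))"

definition alpha :: "'n \<Rightarrow> (ereal^'n^'n) set \<Rightarrow> 'n \<Rightarrow> ereal" where
  "alpha c \<X> i = (SUP p\<in>{p. simple_path (mat_sup \<X>) i p c}. weight (mat_sup \<X>) p)"

definition beta :: "'n \<Rightarrow> (ereal^'n^'n) set \<Rightarrow> 'n \<Rightarrow> ereal" where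
  "beta c \<X> j = (SUP p\<in>{p. simple_path (mat_sup \<X>) c p j}. weight (mat_sup \<X>) p)"

definition gamma :: "'n \<Rightarrow> (ereal^'n^'n) set \<Rightarrow> 'n \<Rightarrow> 'n \<Rightarrow> ereal" where
  "gamma c \<X> i j =
     (SUP p\<in>{p. simple_path (mat_sup \<X>) i p j \<and> c \<notin> set (walk_nodes (mat_sup \<X>) i p)}.
        weight (mat_sup \<X>) p)"

definition w_par :: "'n \<Rightarrow> (ereal^'n^'n) set \<Rightarrow> nat \<Rightarrow> 'n \<Rightarrow> ereal" where
  "w_par c \<X> k i =
     (SUP p\<in>{p. walk (mat_inf \<X>) i p c \<and> length p \<le> k}. weight (mat_inf \<X>) p)"

definition v_par :: "'n \<Rightarrow> (ereal^'n^'n) set \<Rightarrow> nat \<Rightarrow> 'n \<Rightarrow> ereal" where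
  "v_par c \<X> k j =
     (SUP p\<in>{p. walk (mat_inf \<X>) c p j \<and> length p \<le> k}. weight (mat_inf \<X>) p)"

text \<open>
  For \<open>-\<infinity> < l < 0\<close>, division in \<^typ>\<open>ereal\<close> gives \<open>-\<infinity> / l = \<infinity>\<close>, as it should.
  The case \<open>\<gamma> = -\<infinity>\<close> has priority over \<open>l = -\<infinity>\<close>.
\<close>

definition quot :: "ereal \<Rightarrow> ereal \<Rightarrow> ereal" where
  "quot x l = (if l = -\<infinity> then 0 else x / l)"

definition gamma_quot :: "'n \<Rightarrow> (ereal^'n^'n) set \<Rightarrow> nat \<Rightarrow> 'n \<Rightarrow> 'n \<Rightarrow> ereal" where
  "gamma_quot c \<X> k i j =
     (if gamma c \<X> i j = -\<infinity> then -\<infinity>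
      else quot (w_par c \<X> k i + v_par c \<X> k j - gamma c \<X> i j) (lambda_star c \<X>))"

definition alpha_beta_quot :: "'n \<Rightarrow> (ereal^'n^'n) set \<Rightarrow> nat \<Rightarrow> 'n \<Rightarrow> 'n \<Rightarrow> ereal" where
  "alpha_beta_quot c \<X> k i j =
     quot (w_par c \<X> k i - alpha c \<X> i + v_par c \<X> k j - beta c \<X> j) (lambda_star c \<X>)"

end

theory Submission
  imports Defs
begin

text \<open>
  Write \<open>S\<close> and \<open>I\<close> for the entrywise supremum and infimum of the family, \<open>P\<close> for the product
  \<open>A 1 \<otimes>\<^sub>m \<dots> \<otimes>\<^sub>m A k\<close>, and \<open>n\<close> for the number of nodes. An entry \<open>P u v\<close> is the largest weight of
  a walk of length \<open>k\<close> from \<open>u\<close> to \<open>v\<close> whose \<open>t\<close>-th arc is weighted by \<open>A t\<close>. The loop at \<open>c\<close> has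
  weight \<open>0\<close> in every factor, so a walk that visits \<open>c\<close> can wait there at no cost. Conversely,
  excursions from \<open>c\<close> gain nothing, since closed walks of \<open>S\<close> have weight at most \<open>0\<close>.
  In particular \<open>w\<^sub>i \<le> P i c\<close> and \<open>v\<^sub>j \<le> P c j\<close>, because a short walk can be padded with loops.

  The quantitative ingredient is that a stay away from \<open>c\<close> is expensive: a walk avoiding \<open>c\<close> at
  all its arc tails (or at all its arc heads) splits into a path, with at most \<open>n - 1\<close> arcs, and
  cycles that avoid \<open>c\<close>. The cycles contribute at most \<open>\<lambda>\<^sup>*\<close> per arc (lemma
  \<open>walk_weight_le_path_weight\<close>), and \<open>\<lambda>\<^sup>* < 0\<close> since there are only finitely many elementary cycles
  and none that avoids \<open>c\<close> is critical (\<open>lambda_star_neg\<close>).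

  \<^item> For \<open>P i j \<le> P i c + P c j\<close>, take an optimal walk from \<open>i\<close> to \<open>j\<close>. If it visits \<open>c\<close>, cut it
  there and pad both pieces with loops. Otherwise its weight is at most
  \<open>\<gamma>\<^sub>i\<^sub>j + \<lambda>\<^sup>* (k - (n - 1))\<close>, which the first bound on \<open>k\<close> makes smaller than
  \<open>w\<^sub>i + v\<^sub>j \<le> P i c + P c j\<close>.

  \<^item> For \<open>P i c + P c j \<le> P i j\<close>, let \<open>q\<close> be the part of an optimal walk from \<open>i\<close> to \<open>c\<close> up to the
  first visit to \<open>c\<close>, and \<open>r\<close> the part of an optimal walk from \<open>c\<close> to \<open>j\<close> after the last visit.
  Comparing \<open>w\<^sub>i \<le> \<alpha>\<^sub>i + \<lambda>\<^sup>* (|q| - (n - 1))\<close> and \<open>v\<^sub>j \<le> \<beta>\<^sub>j + \<lambda>\<^sup>* (|r| - (n - 1))\<close> with the second bound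
  on \<open>k\<close> gives \<open>|q| + |r| < k\<close>. Hence \<open>q\<close> uses only factors before those used by \<open>r\<close>, and the two
  can be joined by loops at \<open>c\<close> to one walk of length \<open>k\<close> from \<open>i\<close> to \<open>j\<close>.

  If no cycle avoids \<open>c\<close>, then \<open>\<lambda>\<^sup>* = -\<infinity>\<close>. To treat this case together with the finite one, the
  estimates are made for an arbitrary real rate \<open>\<mu>\<close> with \<open>\<lambda>\<^sup>* \<le> \<mu> < 0\<close>, and \<open>rate_below_quot\<close>
  provides a rate for which the bound on \<open>k\<close> is strong enough.
\<close>

section \<open>Walks in digraphs\<close>

context wf_digraph
begin

text \<open>
  The walk is read arc by arc while a path to the current node is maintained. When an arc leads
  back to a node of the path, the arc and the part of the path behind that node form an elementary
  cycle, which is dropped at the price \<open>\<mu>\<close> per arc. The inclusion \<open>set p' \<subseteq> set p\<close> lets properties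
  such as avoidance of a node pass to the path.
\<close>

lemma awalk_reduce_to_apath:
  fixes f :: "'b \<Rightarrow> real" and \<mu> :: real
  assumes "awalk u p v"
    and "\<And>q. cycle q \<Longrightarrow> set q \<subseteq> set p \<Longrightarrow> sum_list (map f q) \<le> \<mu> * real (length q)"
  shows "\<exists>p'. apath u p' v \<and> set p' \<subseteq> set p \<and>
           sum_list (map f p) \<le> sum_list (map f p') + \<mu> * (real (length p) - real (length p'))"
  using assms
proof (induction p arbitrary: v rule: rev_induct)
  case Nil
  then show ?case
    by (intro exI[of _ "[]"]) (auto simp: apath_def)
next
  case (snoc e p)
  have e: "e \<in> arcs G" "head G e = v" and p: "awalk u p (tail G e)"
    using snoc.prems(1) by (auto simp: awalk_simps)
  obtain p' where p': "apath u p' (tail G e)" "set p' \<subseteq> set p"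
      "sum_list (map f p) \<le> sum_list (map f p') + \<mu> * (real (length p) - real (length p'))"
    using snoc.IH[OF p] snoc.prems(2) by fastforce
  have wp': "awalk u p' (tail G e)" and dp': "distinct (awalk_verts u p')"
    using p'(1) by (auto simp: apath_def)
  show ?case
  proof (cases "v \<in> set (awalk_verts u p')")
    case False
    have "awalk u (p' @ [e]) v"
      using wp' e by (auto simp: awalk_simps)
    moreover have "awalk_verts u (p' @ [e]) = awalk_verts u p' @ [v]"
      using awalk_verts_append[OF \<open>awalk u (p' @ [e]) v\<close>] e by simp
    ultimately have "apath u (p' @ [e]) v"
      using False dp' by (simp add: apath_def)
    then show ?thesis
      using p'(2,3) by (intro exI[of _ "p' @ [e]"]) auto
  next
    case True
    then obtain a b where ab: "p' = a @ b" "awalk u a v" "awalk v b (tail G e)"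
      using awalk_decomp[OF wp'] by blast
    have apab: "apath u a v" "apath v b (tail G e)"
      using p'(1) ab unfolding ab(1) apath_append_iff by auto
    have "awalk v (b @ [e]) v"
      using ab(3) e by (auto simp: awalk_simps)
    moreover have "awalk_verts v (b @ [e]) = awalk_verts v b @ [v]"
      using awalk_verts_append[OF \<open>awalk v (b @ [e]) v\<close>] e ab(3) by simp
    moreover obtain t where "awalk_verts v b = v # t"
      using ab(3) by (metis awalk_verts_non_Nil awhd_of_awalk list.collapse)
    ultimately have "cycle (b @ [e])"
      using apab(2) unfolding cycle_def apath_def by (intro exI[of _ v]) simp
    moreover have "set (b @ [e]) \<subseteq> set (p @ [e])"
      using p'(2) ab(1) by auto
    ultimately have "sum_list (map f (b @ [e])) \<le> \<mu> * real (length (b @ [e]))"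
      using snoc.prems(2) by blast
    then have "sum_list (map f (p @ [e])) \<le>
        sum_list (map f a) + \<mu> * (real (length (p @ [e])) - real (length a))"
      using p'(3) ab(1) by (simp add: algebra_simps)
    then show ?thesis
      using apab(1) p'(2) ab(1) by (intro exI[of _ a]) auto
  qed
qed

lemma awalk_split_first_visit:
  assumes "awalk u p v" "x \<in> set (awalk_verts u p)"
  shows "\<exists>q r. p = q @ r \<and> awalk u q x \<and> awalk x r v \<and> x \<notin> tail G ` set q"
  using assms
proof (induction p arbitrary: u)
  case Nil
  then show ?case by (auto simp: awalk_simps)
next
  case (Cons e p)
  show ?case
  proof (cases "x = u")
    case True
    then show ?thesis
      using Cons.prems by (intro exI[of _ "[]"] exI[of _ "e # p"]) (auto simp: awalk_simps)
  next
    case False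
    with Cons.prems obtain q r where
      "p = q @ r" "awalk (head G e) q x" "awalk x r v" "x \<notin> tail G ` set q"
      using Cons.IH[of "head G e"] by (auto simp: awalk_simps)
    then show ?thesis
      using Cons.prems False
      by (intro exI[of _ "e # q"] exI[of _ r]) (auto simp: awalk_Cons_iff)
  qed
qed

lemma awalk_split_last_visit:
  assumes "awalk u p v" "x \<in> set (awalk_verts u p)"
  shows "\<exists>q r. p = q @ r \<and> awalk u q x \<and> awalk x r v \<and> x \<notin> head G ` set r"
  using assms
proof (induction p arbitrary: v rule: rev_induct)
  case Nil
  then show ?case by (auto simp: awalk_simps)
next
  case (snoc e p)
  have e: "e \<in> arcs G" "head G e = v" and p: "awalk u p (tail G e)"
    using snoc.prems(1) by (auto simp: awalk_simps)
  show ?case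
  proof (cases "x = v")
    case True
    then show ?thesis
      using snoc.prems(1) e
      by (intro exI[of _ "p @ [e]"] exI[of _ "[]"]) (auto simp: awalk_simps)
  next
    case False
    have "awalk_verts u (p @ [e]) = awalk_verts u p @ [v]"
      using awalk_verts_append[OF snoc.prems(1)] e by simp
    with snoc.prems(2) False have "x \<in> set (awalk_verts u p)" by simp
    then obtain q r where
      "p = q @ r" "awalk u q x" "awalk x r (tail G e)" "x \<notin> head G ` set r"
      using snoc.IH[OF p] by blast
    then show ?thesis
      using e False by (intro exI[of _ q] exI[of _ "r @ [e]"]) (auto simp: awalk_simps)
  qed
qed

text \<open>
  The next two lemmas translate between cyclic node sequences, as in the definition of \<open>\<lambda>\<^sup>*\<close>, and
  closed arc walks.
\<close>

lemma awalk_of_vertex_sequence: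
  assumes "\<And>t. t < m \<Longrightarrow> e t \<in> arcs G \<and> tail G (e t) = g t \<and> head G (e t) = g (Suc t)"
    and "g 0 \<in> verts G"
  shows "awalk (g 0) (map e [0..<m]) (g m)"
  using assms
proof (induction m)
  case 0
  then show ?case by (simp add: awalk_Nil_iff)
next
  case (Suc m)
  have "awalk (g 0) (map e [0..<m]) (g m)"
    using Suc by simp
  moreover have "awalk (g m) [e m] (g (Suc m))"
    using Suc.prems(1)[of m] head_in_verts[of "e m"] by (auto simp: awalk_simps)
  ultimately show ?case
    by simp
qed

lemma closed_awalk_head_eq_tail_next:
  assumes "awalk u p u" "t < length p"
  shows "head G (p ! t) = tail G (p ! (Suc t mod length p))"
proof -
  have p: "p \<noteq> []" using assms(2) by auto
  have "tail G (hd p) # map (head G) p = map (tail G) p @ [head G (last p)]"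
    using awalk_verts_conv[of u p] awalk_verts_conv'[of u p u] assms(1) p by (auto simp: awalk_def)
  then have "map (head G) p ! t = (map (tail G) p @ [head G (last p)]) ! Suc t"
    by (metis nth_Cons_Suc)
  moreover have "head G (last p) = u" "tail G (p ! 0) = u"
    using assms(1) p by (auto simp: awalk_verts_conv awalk_conv neq_Nil_conv)
  ultimately show ?thesis
    using assms(2) p by (cases "Suc t = length p") (auto simp: nth_append last_conv_nth)
qed

end

section \<open>Max-plus products as optimal walk weights\<close>

interpretation mat_digraph: fin_digraph "digraph_of A" for A :: "ereal^'n::finite^'n"
  by unfold_locales (auto simp: digraph_of_def)

lemma digraph_of_simps [simp]:
  "verts (digraph_of A) = UNIV" "arcs (digraph_of A) = edges A"
  "tail (digraph_of A) = fst" "head (digraph_of A) = snd"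
  by (simp_all add: digraph_of_def)

lemma mem_edges: "e \<in> edges A \<longleftrightarrow> A $ fst e $ snd e \<noteq> -\<infinity>"
  by (auto simp: edges_def)

text \<open>
  The weight of a walk whose first arc is traversed with the factor \<open>A (s + 1)\<close>, its second arc
  with \<open>A (s + 2)\<close>, and so on. The offset \<open>s\<close> makes it possible to cut walks into consecutive
  pieces.
\<close>

fun trellis_weight :: "(nat \<Rightarrow> ereal^'n^'n) \<Rightarrow> nat \<Rightarrow> ('n \<times> 'n) list \<Rightarrow> ereal" where
  "trellis_weight A s [] = 0"
| "trellis_weight A s (e # p) = A (Suc s) $ fst e $ snd e + trellis_weight A (Suc s) p"

lemma trellis_weight_append:
  "trellis_weight A s (p @ q) = trellis_weight A s p + trellis_weight A (s + length p) q"
  by (induction p arbitrary: s) (auto simp: add.assoc)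

lemma trellis_weight_mono:
  assumes "\<And>t i j. s < t \<Longrightarrow> t \<le> s + length p \<Longrightarrow> A t $ i $ j \<le> B t $ i $ j"
  shows "trellis_weight A s p \<le> trellis_weight B s p"
  using assms
proof (induction p arbitrary: s)
  case (Cons e p)
  show ?case
    using Cons.prems by (auto intro!: add_mono Cons.IH)
qed simp

lemma trellis_weight_const: "trellis_weight (\<lambda>_. A) s p = weight A p"
  by (induction p arbitrary: s) (auto simp: weight_def case_prod_beta)

lemma trellis_weight_loops:
  assumes "\<And>t. s < t \<Longrightarrow> t \<le> s + m \<Longrightarrow> A t $ c $ c = 0"
  shows "trellis_weight A s (replicate m (c, c)) = 0"
  using assms by (induction m arbitrary: s) auto

lemma trellis_weight_le_mp_prod:
  assumes "walk B u p v"
  shows "trellis_weight A 0 p \<le> mp_prod A (length p) $ u $ v"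
  using assms
proof (induction p arbitrary: v rule: rev_induct)
  case Nil
  then show ?case by (simp add: mp_one_def mat_digraph.awalk_simps)
next
  case (snoc e p)
  have e: "walk B u p (fst e)" "snd e = v"
    using snoc.prems by (auto simp: mat_digraph.awalk_simps)
  have "trellis_weight A 0 (p @ [e])
      \<le> mp_prod A (length p) $ u $ fst e + A (Suc (length p)) $ fst e $ v"
    using snoc.IH[OF e(1)] e(2) by (auto simp: trellis_weight_append intro: add_right_mono)
  also have "\<dots> \<le> mp_prod A (Suc (length p)) $ u $ v"
    by (auto simp: mp_mult_def intro!: Max_ge)
  finally show ?case by simp
qed

lemma mp_prod_ne_PInf:
  assumes "\<And>t. 1 \<le> t \<Longrightarrow> t \<le> k \<Longrightarrow> rmax_mat (A t)"
  shows "mp_prod A k $ u $ v \<noteq> \<infinity>"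
  using assms
proof (induction k arbitrary: v)
  case 0
  then show ?case by (simp add: mp_one_def)
next
  case (Suc k)
  let ?h = "\<lambda>l. mp_prod A k $ u $ l + A (Suc k) $ l $ v"
  have "Max (range ?h) \<in> range ?h"
    by (rule Max_in) auto
  moreover have "?h l \<noteq> \<infinity>" for l
    using Suc.IH[of l] Suc.prems by (simp add: rmax_mat_def)
  ultimately show ?case
    by (force simp: mp_mult_def)
qed

text \<open>
  Entries \<open>\<infinity>\<close> must be excluded: in \<^typ>\<open>ereal\<close> the sum \<open>-\<infinity> + \<infinity>\<close> is \<open>\<infinity>\<close>, so a factor with
  such an entry could contribute through a step that is not an arc.
\<close>

lemma mp_prod_attained:
  assumes "\<And>t. 1 \<le> t \<Longrightarrow> t \<le> k \<Longrightarrow> rmax_mat (A t)"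
    and "\<And>t. 1 \<le> t \<Longrightarrow> t \<le> k \<Longrightarrow> edges (A t) = edges B"
    and "mp_prod A k $ u $ v \<noteq> -\<infinity>"
  shows "\<exists>p. walk B u p v \<and> length p = k \<and> trellis_weight A 0 p = mp_prod A k $ u $ v"
  using assms
proof (induction k arbitrary: v)
  case 0
  then show ?case
    by (intro exI[of _ "[]"]) (auto simp: mp_one_def mat_digraph.awalk_simps split: if_splits)
next
  case (Suc k)
  let ?h = "\<lambda>l. mp_prod A k $ u $ l + A (Suc k) $ l $ v"
  have "mp_prod A (Suc k) $ u $ v = Max (range ?h)"
    by (simp add: mp_mult_def)
  moreover have "Max (range ?h) \<in> range ?h"
    by (rule Max_in) auto
  ultimately have "mp_prod A (Suc k) $ u $ v \<in> range ?h" by (simp only:)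
  then obtain l where l: "mp_prod A (Suc k) $ u $ v = ?h l" by blast
  with Suc.prems(3) have "mp_prod A k $ u $ l \<noteq> -\<infinity>" "A (Suc k) $ l $ v \<noteq> -\<infinity>"
    using mp_prod_ne_PInf[of k A u l] Suc.prems(1) by (auto simp: rmax_mat_def)
  moreover from this Suc.prems have
    "\<exists>p. walk B u p l \<and> length p = k \<and> trellis_weight A 0 p = mp_prod A k $ u $ l"
    by (intro Suc.IH) simp_all
  ultimately obtain p where p:
    "walk B u p l" "length p = k" "trellis_weight A 0 p = mp_prod A k $ u $ l"
    by blast
  have "(l, v) \<in> edges B"
    using Suc.prems(2)[of "Suc k"] \<open>A (Suc k) $ l $ v \<noteq> -\<infinity>\<close> by (auto simp: edges_def)
  then show ?case
    using p l by (intro exI[of _ "p @ [(l, v)]"])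
      (auto simp: trellis_weight_append mat_digraph.awalk_simps)
qed

section \<open>Consequences of the standing assumptions\<close>

locale common_critical_loop =
  fixes c :: "'n::finite" and \<X> :: "(ereal^'n^'n) set"
  assumes nonempty: "\<X> \<noteq> {}"
    and rmax: "X \<in> \<X> \<Longrightarrow> rmax_mat X"
    and irreducible: "X \<in> \<X> \<Longrightarrow> irreducible_mat X"
    and edges_eq: "X \<in> \<X> \<Longrightarrow> Y \<in> \<X> \<Longrightarrow> edges X = edges Y"
    and edges_inf_eq: "X \<in> \<X> \<Longrightarrow> edges (mat_inf \<X>) = edges X"
    and critical: "X \<in> \<X> \<Longrightarrow> unique_critical_loop c X"
    and critical_sup: "unique_critical_loop c (mat_sup \<X>)"
begin

abbreviation S :: "ereal^'n^'n" where "S \<equiv> mat_sup \<X>"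
abbreviation I :: "ereal^'n^'n" where "I \<equiv> mat_inf \<X>"

lemma mat_le_sup: "X \<in> \<X> \<Longrightarrow> X $ u $ v \<le> S $ u $ v"
  by (auto simp: mat_sup_def intro: SUP_upper)

lemma inf_le_mat: "X \<in> \<X> \<Longrightarrow> I $ u $ v \<le> X $ u $ v"
  by (auto simp: mat_inf_def intro: INF_lower)

text \<open>
  All matrices in sight, \<open>S\<close> and \<open>I\<close> included, have the same digraph, so every walk is regarded as
  a walk of \<open>S\<close>.
\<close>

lemma edges_sup_eq:
  assumes "X \<in> \<X>"
  shows "edges X = edges S"
proof -
  have "S $ u $ v = -\<infinity> \<longleftrightarrow> X $ u $ v = -\<infinity>" for u v
  proof -
    have "S $ u $ v = -\<infinity> \<longleftrightarrow> (\<forall>Y\<in>\<X>. Y $ u $ v = -\<infinity>)"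
      using SUP_le_iff[of "\<lambda>Y. Y $ u $ v" \<X> "-\<infinity>"] by (simp add: mat_sup_def)
    moreover have "Y $ u $ v = -\<infinity> \<longleftrightarrow> X $ u $ v = -\<infinity>" if "Y \<in> \<X>" for Y
      using edges_eq[OF assms that] mem_edges[of "(u, v)" X] mem_edges[of "(u, v)" Y] by simp
    ultimately show ?thesis
      using assms by blast
  qed
  then show ?thesis by (simp add: edges_def)
qed

lemma digraph_eq:
  "X \<in> \<X> \<Longrightarrow> digraph_of X = digraph_of S" "digraph_of I = digraph_of S"
  using nonempty edges_inf_eq edges_sup_eq by (auto simp: digraph_of_def)

lemma walk_exists: "\<exists>p. walk S u p v"
proof -
  obtain X where "X \<in> \<X>" using nonempty by blast
  then have "strongly_connected (digraph_of S)"
    using irreducible[of X] by (simp add: irreducible_mat_def digraph_eq(1))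
  then show ?thesis
    by (simp add: strongly_connected_def mat_digraph.reachable_awalk)
qed

lemma path_exists: "\<exists>p. simple_path S u p v"
  using walk_exists mat_digraph.reachable_apath mat_digraph.reachable_awalk by metis

lemma loop_edge: "(c, c) \<in> edges S"
proof -
  have "critical_cycle S [(c, c)]"
    using critical_sup by (auto simp: unique_critical_loop_def)
  then show ?thesis
    by (auto simp: critical_cycle_def pre_digraph.cycle_def mat_digraph.awalk_simps)
qed

lemma loop_weight_eq_0: "X \<in> \<X> \<Longrightarrow> X $ c $ c = 0"
  using critical by (simp add: unique_critical_loop_def weight_def)

text \<open>The critical loop of \<open>S\<close> has mean \<open>0\<close> and maximises the mean over all closed walks.\<close>

lemma closed_walk_mean_le_0:
  assumes "walk S u p u" "p \<noteq> []"
  shows "mean_weight S p \<le> 0"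
proof -
  have "critical_cycle S [(c, c)]" "weight S [(c, c)] = 0"
    using critical_sup by (auto simp: unique_critical_loop_def)
  then show ?thesis
    using assms by (auto simp: critical_cycle_def mean_weight_def)
qed

lemma closed_walk_weight_le_0:
  assumes "walk S u p u"
  shows "weight S p \<le> 0"
proof (cases "p = []")
  case False
  then show ?thesis
    using closed_walk_mean_le_0[OF assms] ereal_divide_right_mono
    by (cases "weight S p") (auto simp: mean_weight_def divide_le_0_iff ereal_divide_eq)
qed (simp add: weight_def)

text \<open>
  A supremum of finite entries could be \<open>\<infinity>\<close>. By irreducibility each arc lies on a closed walk, and
  an arc of weight \<open>\<infinity>\<close> would make the weight of that walk \<open>\<infinity>\<close> instead of at most \<open>0\<close>.
\<close>

lemma sup_edge_finite:
  assumes "e \<in> edges S"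
  shows "\<bar>S $ fst e $ snd e\<bar> \<noteq> \<infinity>"
proof -
  obtain p where "walk S (snd e) p (fst e)"
    using walk_exists by blast
  then have "walk S (fst e) (e # p) (fst e)"
    using assms by (auto simp: mat_digraph.awalk_simps)
  then have "weight S (e # p) \<le> 0"
    by (rule closed_walk_weight_le_0)
  then have "S $ fst e $ snd e + weight S p \<le> 0"
    by (simp add: weight_def case_prod_beta)
  then show ?thesis
    using assms by (auto simp: mem_edges)
qed

definition sup_weight :: "'n \<times> 'n \<Rightarrow> real" where
  "sup_weight e = real_of_ereal (S $ fst e $ snd e)"

lemma weight_sup_eq:
  assumes "set p \<subseteq> edges S"
  shows "weight S p = ereal (sum_list (map sup_weight p))"
  using assms
  by (induction p)
    (auto simp: weight_def sup_weight_def case_prod_beta ereal_real dest!: sup_edge_finite)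

lemma weight_inf_ne_MInf:
  assumes "set p \<subseteq> edges S"
  shows "weight I p \<noteq> -\<infinity>"
proof -
  have "edges I = edges S" using edges_inf_eq edges_sup_eq nonempty by blast
  then show ?thesis using assms
  proof (induction p)
    case (Cons e p)
    then have "I $ fst e $ snd e \<noteq> -\<infinity>" "weight I p \<noteq> -\<infinity>" by (auto simp: mem_edges)
    then show ?case by (simp add: weight_def case_prod_beta)
  qed (simp add: weight_def)
qed

lemma sum_closed_seq_eq:
  assumes "p \<noteq> []" "\<And>t. t < length p \<Longrightarrow> (p ! t, p ! (Suc t mod length p)) \<in> edges S"
  defines "q \<equiv> map (\<lambda>t. (p ! t, p ! (Suc t mod length p))) [0..<length p]"
  shows "walk S (hd p) q (hd p)"
    and "(\<Sum>t<length p. S $ (p ! t) $ (p ! (Suc t mod length p))) = weight S q"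
proof -
  show "walk S (hd p) q (hd p)"
    using mat_digraph.awalk_of_vertex_sequence[of "length p" "\<lambda>t. (p ! t, p ! (Suc t mod length p))" S
        "\<lambda>t. p ! (t mod length p)"] assms by (simp add: hd_conv_nth)
  show "(\<Sum>t<length p. S $ (p ! t) $ (p ! (Suc t mod length p))) = weight S q"
    by (simp add: q_def weight_def comp_def interv_sum_list_conv_sum_set_nat atLeast0LessThan)
qed

text \<open>
  An elementary cycle avoiding \<open>c\<close> with mean \<open>0\<close> would be a second critical cycle, so all these
  means are negative; as there are finitely many of them, they are bounded away from \<open>0\<close>.
\<close>

lemma elementary_cycles_bound:
  "\<exists>\<mu><0. \<forall>q. mat_digraph.cycle S q \<and> c \<notin> fst ` set q \<longrightarrow>
     sum_list (map sup_weight q) \<le> \<mu> * real (length q)"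
proof -
  let ?C = "{q. mat_digraph.cycle S q \<and> c \<notin> fst ` set q}"
  let ?m = "\<lambda>q. sum_list (map sup_weight q) / real (length q)"
  have "?C \<subseteq> {q. set q \<subseteq> UNIV \<and> distinct q}"
    by (auto simp: mat_digraph.cycle_conv)
  then have fin: "finite ?C"
    by (rule finite_subset[OF _ finite_subset_distinct]) simp
  have neg: "?m q < 0" if q: "q \<in> ?C" for q
  proof -
    from q obtain u where u: "walk S u q u" "q \<noteq> []" by (auto simp: pre_digraph.cycle_def)
    have m: "mean_weight S q = ereal (?m q)"
      using u by (simp add: mean_weight_def weight_sup_eq pre_digraph.awalk_def)
    have "q \<noteq> [(c, c)]" using q by auto
    then have "\<not> critical_cycle S q"
      using critical_sup by (auto simp: unique_critical_loop_def)
    then obtain v r where "walk S v r v" "r \<noteq> []" "\<not> mean_weight S r \<le> mean_weight S q"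
      using q by (auto simp: critical_cycle_def)
    then have "mean_weight S q < 0"
      using closed_walk_mean_le_0 by (meson not_le less_le_trans)
    then show ?thesis by (simp add: m)
  qed
  \<comment> \<open>The element \<open>-1\<close> covers the case without cycles that avoid \<open>c\<close>.\<close>
  let ?\<mu> = "Max (insert (-1) (?m ` ?C))"
  have "?\<mu> < 0"
    using fin neg by (subst Max_less_iff) auto
  moreover have "sum_list (map sup_weight q) \<le> ?\<mu> * real (length q)" if "q \<in> ?C" for q
  proof -
    have "?m q \<le> ?\<mu>" using fin that by (intro Max_ge) auto
    moreover have "q \<noteq> []" using that by (auto simp: pre_digraph.cycle_def)
    ultimately show ?thesis by (simp add: divide_le_eq)
  qed
  ultimately show ?thesis by blast
qed

lemma closed_walk_fst_eq_snd:
  assumes "walk S u p u"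
  shows "fst ` set p = snd ` set p"
proof (cases "p = []")
  case False
  have "set (fst (hd p) # map snd p) = set (map fst p @ [snd (last p)])"
    using mat_digraph.awalk_verts_conv[of S u p] mat_digraph.awalk_verts_conv'[of S u p u] assms False
    by (auto simp: pre_digraph.awalk_def simp del: set_simps)
  moreover have "fst (hd p) = u" "snd (last p) = u"
    using assms False by (auto simp: mat_digraph.awalk_verts_conv mat_digraph.awalk_conv neq_Nil_conv)
  moreover have "fst (hd p) \<in> fst ` set p" "snd (last p) \<in> snd ` set p"
    using False by auto
  ultimately show ?thesis by (simp add: insert_absorb)
qed simp

text \<open>
  Reducing a closed walk to a path leaves the empty path, so the bound for elementary cycles
  extends to all closed walks avoiding \<open>c\<close>. A cyclic sequence that is not a walk contributes
  \<open>-\<infinity>\<close> to the supremum.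
\<close>

lemma lambda_star_neg: "lambda_star c \<X> < 0"
proof -
  obtain \<mu> where \<mu>: "\<mu> < 0" "\<And>q. mat_digraph.cycle S q \<Longrightarrow> c \<notin> fst ` set q \<Longrightarrow>
      sum_list (map sup_weight q) \<le> \<mu> * real (length q)"
    using elementary_cycles_bound by blast
  have "lambda_star c \<X> \<le> ereal \<mu>"
    unfolding lambda_star_def
  proof (rule SUP_least, clarsimp)
    fix p :: "'n list"
    assume p: "p \<noteq> []" "c \<notin> set p"
    let ?s = "\<Sum>t<length p. S $ (p ! t) $ (p ! (Suc t mod length p))"
    show "?s / ereal (real (length p)) \<le> ereal \<mu>"
    proof (cases "\<forall>t<length p. (p ! t, p ! (Suc t mod length p)) \<in> edges S")
      case True
      define q where "q = map (\<lambda>t. (p ! t, p ! (Suc t mod length p))) [0..<length p]"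
      have q: "walk S (hd p) q (hd p)" "?s = weight S q"
        using sum_closed_seq_eq p True unfolding q_def by blast+
      have "c \<notin> fst ` set q"
        using p by (auto simp: q_def)
      then obtain q' where q': "simple_path S (hd p) q' (hd p)"
        "sum_list (map sup_weight q) \<le>
          sum_list (map sup_weight q') + \<mu> * (real (length q) - real (length q'))"
        using mat_digraph.awalk_reduce_to_apath[OF q(1), of sup_weight \<mu>] \<mu>(2) by blast
      then have "q' = []"
        using mat_digraph.apath_nonempty_ends by blast
      then have "sum_list (map sup_weight q) \<le> \<mu> * real (length p)"
        using q'(2) by (simp add: q_def)
      then show ?thesis
        using p q by (simp add: weight_sup_eq pre_digraph.awalk_def divide_le_eq)
    next
      case False
      then obtain t where t: "t < length p" "S $ (p ! t) $ (p ! (Suc t mod length p)) = -\<infinity>"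
        by (auto simp: edges_def)
      have "S $ u $ v \<noteq> \<infinity>" for u v
        using sup_edge_finite[of "(u, v)"] by (auto simp: mem_edges)
      then have "?s = -\<infinity>"
        using t by (subst sum.remove[of _ t]) (auto simp: sum_Pinfty)
      then show ?thesis using p by simp
    qed
  qed
  then show ?thesis
    by (rule le_less_trans) (simp add: \<mu>(1))
qed

lemma closed_walk_le_lambda_star:
  assumes "walk S u q u" "q \<noteq> []" "c \<notin> fst ` set q"
  shows "ereal (sum_list (map sup_weight q) / real (length q)) \<le> lambda_star c \<X>"
proof -
  let ?p = "map fst q"
  have "(\<Sum>t<length ?p. S $ (?p ! t) $ (?p ! (Suc t mod length ?p))) / ereal (real (length ?p))
      \<le> lambda_star c \<X>"
    unfolding lambda_star_def using assms by (intro SUP_upper) auto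
  moreover have "(\<Sum>t<length ?p. S $ (?p ! t) $ (?p ! (Suc t mod length ?p))) = weight S q"
  proof -
    have "weight S q = (\<Sum>t<length q. S $ fst (q ! t) $ snd (q ! t))"
      by (simp add: weight_def case_prod_beta sum_list_sum_nth atLeast0LessThan)
    also have "\<dots> = (\<Sum>t<length ?p. S $ (?p ! t) $ (?p ! (Suc t mod length ?p)))"
      using mat_digraph.closed_awalk_head_eq_tail_next[OF assms(1)] assms(2)
      by (intro sum.cong) auto
    finally show ?thesis by simp
  qed
  ultimately show ?thesis
    using assms by (simp add: weight_sup_eq pre_digraph.awalk_def)
qed

text \<open>
  For a negative rate, the reduction to a path is weakest when the path is longest, hence the
  term \<open>n - 1\<close>. The two alternatives for avoiding \<open>c\<close> apply to a walk ending with its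
  first visit to \<open>c\<close> and to a walk starting with its last visit. On closed subwalks they coincide,
  as the tails of a closed walk are its heads.
\<close>

lemma walk_weight_le_path_weight:
  assumes "walk S u p v" "c \<notin> fst ` set p \<or> c \<notin> snd ` set p"
    and "\<mu> < 0" "lambda_star c \<X> \<le> ereal \<mu>"
  shows "\<exists>p'. simple_path S u p' v \<and> set p' \<subseteq> set p \<and>
     weight S p \<le> weight S p' + ereal (\<mu> * (real (length p) - (real CARD('n) - 1)))"
proof -
  have "sum_list (map sup_weight q) \<le> \<mu> * real (length q)"
    if q: "mat_digraph.cycle S q" "set q \<subseteq> set p" for q
  proof -
    from q(1) obtain u where u: "walk S u q u" "q \<noteq> []" by (auto simp: pre_digraph.cycle_def)
    have "c \<notin> fst ` set q"
      using assms(2) q(2) closed_walk_fst_eq_snd[OF u(1)] by blast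
    then have "ereal (sum_list (map sup_weight q) / real (length q)) \<le> ereal \<mu>"
      using closed_walk_le_lambda_star[OF u] assms(4) order_trans by blast
    then show ?thesis using u(2) by (simp add: divide_le_eq)
  qed
  then obtain p' where p': "simple_path S u p' v" "set p' \<subseteq> set p"
    "sum_list (map sup_weight p) \<le>
      sum_list (map sup_weight p') + \<mu> * (real (length p) - real (length p'))"
    using mat_digraph.awalk_reduce_to_apath[OF assms(1)] by blast
  have "length p' < CARD('n)"
    using mat_digraph.length_apath_less[OF p'(1)] by simp
  then have "\<mu> * (real (length p) - real (length p')) \<le> \<mu> * (real (length p) - (real CARD('n) - 1))"
    using assms(3) by (intro mult_left_mono_neg) auto
  with p'(3) have "sum_list (map sup_weight p) \<le>
      sum_list (map sup_weight p') + \<mu> * (real (length p) - (real CARD('n) - 1))"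
    by linarith
  moreover have "set p \<subseteq> edges S"
    using assms(1) by (auto simp: pre_digraph.awalk_def)
  ultimately show ?thesis
    using p'(1,2) by (intro exI[of _ p']) (auto simp: weight_sup_eq)
qed

lemma finite_paths_SUP_finite:
  assumes "P \<subseteq> {p. simple_path S u p v}" "P \<noteq> {}"
  shows "\<bar>SUP p\<in>P. weight S p\<bar> \<noteq> \<infinity>"
proof -
  have "finite P"
    using assms(1) mat_digraph.apaths_finite finite_subset by blast
  then have "(SUP p\<in>P. weight S p) \<in> weight S ` P"
    using assms(2) by (metis Max_Sup Max_in finite_imageI image_is_empty)
  then obtain p where "p \<in> P" "(SUP p\<in>P. weight S p) = weight S p" by blast
  moreover have "set p \<subseteq> edges S"
    using \<open>p \<in> P\<close> assms(1) by (auto simp: pre_digraph.apath_def pre_digraph.awalk_def)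
  ultimately show ?thesis by (simp add: weight_sup_eq)
qed

end

text \<open>
  For finite \<open>l\<close> the rate is \<open>l\<close> itself. For \<open>l = -\<infinity>\<close> the hypothesis says only \<open>m < k\<close>, and any
  sufficiently negative rate will do.
\<close>

lemma rate_below_quot:
  assumes "l < 0" "quot (ereal x) l + ereal m < ereal k"
  shows "\<exists>\<mu><0. l \<le> ereal \<mu> \<and> \<mu> * (k - m) < x"
proof (cases l)
  case (real r)
  then have "r < 0" "x / r < k - m"
    using assms by (auto simp: quot_def)
  then show ?thesis
    using real by (intro exI[of _ r]) (simp add: field_simps)
next
  case MInf
  then have d: "0 < k - m"
    using assms(2) by (simp add: quot_def)
  \<comment> \<open>The rate \<open>(x - 1) / (k - m)\<close> gives \<open>x - 1 < x\<close>; the minimum with \<open>-1\<close> makes it negative.\<close>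
  have "min (-1) ((x - 1) / (k - m)) * (k - m) \<le> (x - 1) / (k - m) * (k - m)"
    using d by (intro mult_right_mono) auto
  also have "\<dots> < x"
    using d by simp
  finally show ?thesis
    using MInf by (intro exI[of _ "min (-1) ((x - 1) / (k - m))"]) simp
qed (use assms in simp)

context common_critical_loop
begin

lemma alpha_finite: "\<bar>alpha c \<X> u\<bar> \<noteq> \<infinity>"
  and beta_finite: "\<bar>beta c \<X> u\<bar> \<noteq> \<infinity>"
  unfolding alpha_def beta_def
  by (rule finite_paths_SUP_finite[OF subset_refl]; simp add: path_exists)+

lemma gamma_finite:
  assumes "simple_path S u p v" "c \<notin> set (walk_nodes S u p)"
  shows "\<bar>gamma c \<X> u v\<bar> \<noteq> \<infinity>"
  unfolding gamma_def using assms by (intro finite_paths_SUP_finite[of _ u v]) auto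

text \<open>
  Paths have at most \<open>n - 1\<close> arcs, so as soon as \<open>n - 1 \<le> k\<close> the parameters \<open>w\<close> and \<open>v\<close> are suprema
  over nonempty sets.
\<close>

lemma exists_short_inf_walk:
  assumes "CARD('n) - 1 \<le> k"
  shows "\<exists>p. walk I u p v \<and> length p \<le> k \<and> weight I p \<noteq> -\<infinity>"
proof -
  obtain p where p: "simple_path S u p v" using path_exists by blast
  then have "length p \<le> k" using mat_digraph.length_apath_less[OF p] assms by simp
  moreover have "walk S u p v" "set p \<subseteq> edges S"
    using p by (auto simp: pre_digraph.apath_def pre_digraph.awalk_def)
  ultimately show ?thesis
    using weight_inf_ne_MInf by (auto simp: digraph_eq)
qed

lemma w_par_ne_MInf:
  assumes "CARD('n) - 1 \<le> k"
  shows "w_par c \<X> k u \<noteq> -\<infinity>"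
proof -
  obtain p where p: "walk I u p c" "length p \<le> k" "weight I p \<noteq> -\<infinity>"
    using exists_short_inf_walk[OF assms] by blast
  have "weight I p \<le> w_par c \<X> k u"
    unfolding w_par_def using p(1,2) by (intro SUP_upper) simp
  then show ?thesis using p(3) by auto
qed

lemma v_par_ne_MInf:
  assumes "CARD('n) - 1 \<le> k"
  shows "v_par c \<X> k u \<noteq> -\<infinity>"
proof -
  obtain p where p: "walk I c p u" "length p \<le> k" "weight I p \<noteq> -\<infinity>"
    using exists_short_inf_walk[OF assms] by blast
  have "weight I p \<le> v_par c \<X> k u"
    unfolding v_par_def using p(1,2) by (intro SUP_upper) simp
  then show ?thesis using p(3) by auto
qed

end

section \<open>Products of members of the family\<close>

locale common_critical_loop_product = common_critical_loop c \<X>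
  for c :: "'n::finite" and \<X> :: "(ereal^'n^'n) set" +
  fixes A :: "nat \<Rightarrow> ereal^'n^'n" and k :: nat
  assumes factors: "1 \<le> t \<Longrightarrow> t \<le> k \<Longrightarrow> A t \<in> \<X>"
begin

lemma prod_ne_PInf: "mp_prod A k $ u $ v \<noteq> \<infinity>"
  using factors rmax by (intro mp_prod_ne_PInf) auto

lemma prod_attained:
  assumes "mp_prod A k $ u $ v \<noteq> -\<infinity>"
  obtains p where "walk S u p v" "length p = k" "trellis_weight A 0 p = mp_prod A k $ u $ v"
proof -
  have "\<exists>p. walk S u p v \<and> length p = k \<and> trellis_weight A 0 p = mp_prod A k $ u $ v"
    using factors rmax edges_sup_eq assms by (intro mp_prod_attained) simp_all
  then show thesis using that by blast
qed

lemma trellis_weight_le_sup: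
  "s + length p \<le> k \<Longrightarrow> trellis_weight A s p \<le> weight S p"
  unfolding trellis_weight_const[of S s, symmetric]
  using factors mat_le_sup by (intro trellis_weight_mono) auto

lemma inf_le_trellis_weight:
  "s + length p \<le> k \<Longrightarrow> weight I p \<le> trellis_weight A s p"
  unfolding trellis_weight_const[of I s, symmetric]
  using factors inf_le_mat by (intro trellis_weight_mono) auto

text \<open>
  This is where the loop of weight \<open>0\<close> enters: a walk into \<open>c\<close>, using the first factors, and a walk
  out of \<open>c\<close>, using the last factors, are joined by waiting at \<open>c\<close>. With one of them empty, the
  other is padded to the full length \<open>k\<close>.
\<close>

lemma glue_at_loop:
  assumes "walk S u p c" "walk S c q v" "length p + length q \<le> k"
  shows "trellis_weight A 0 p + trellis_weight A (k - length q) q \<le> mp_prod A k $ u $ v"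
proof -
  define m where "m = k - length p - length q"
  let ?r = "p @ replicate m (c, c) @ q"
  have "walk S c (replicate m (c, c)) c"
    using loop_edge by (induction m) (auto simp: mat_digraph.awalk_simps)
  then have "walk S u ?r v"
    using assms by (blast intro: mat_digraph.awalk_appendI)
  then have "trellis_weight A 0 ?r \<le> mp_prod A (length ?r) $ u $ v"
    by (rule trellis_weight_le_mp_prod)
  moreover have "length p + m = k - length q" "length ?r = k"
    using assms(3) by (auto simp: m_def)
  moreover have "trellis_weight A (length p) (replicate m (c, c)) = 0"
    using factors loop_weight_eq_0 assms(3) by (intro trellis_weight_loops) (auto simp: m_def)
  ultimately show ?thesis
    by (simp add: trellis_weight_append)
qed

lemma w_par_le_prod: "w_par c \<X> k u \<le> mp_prod A k $ u $ c"
  unfolding w_par_def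
proof (rule SUP_least)
  fix p assume "p \<in> {p. walk I u p c \<and> length p \<le> k}"
  then have p: "walk S u p c" "length p \<le> k" by (auto simp: digraph_eq)
  have "weight I p \<le> trellis_weight A 0 p"
    using p by (intro inf_le_trellis_weight) auto
  also have "\<dots> \<le> mp_prod A k $ u $ c"
    using glue_at_loop[OF p(1), of "[]" c] p(2) by (simp add: mat_digraph.awalk_simps)
  finally show "weight I p \<le> mp_prod A k $ u $ c" .
qed

lemma v_par_le_prod: "v_par c \<X> k v \<le> mp_prod A k $ c $ v"
  unfolding v_par_def
proof (rule SUP_least)
  fix p assume "p \<in> {p. walk I c p v \<and> length p \<le> k}"
  then have p: "walk S c p v" "length p \<le> k" by (auto simp: digraph_eq)
  have "weight I p \<le> trellis_weight A (k - length p) p"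
    using p by (intro inf_le_trellis_weight) auto
  also have "\<dots> \<le> mp_prod A k $ c $ v"
    using glue_at_loop[OF _ p(1), of c "[]"] p(2) by (simp add: mat_digraph.awalk_simps)
  finally show "weight I p \<le> mp_prod A k $ c $ v" .
qed

text \<open>
  Whatever an optimal walk to \<open>c\<close> does after its first visit to \<open>c\<close> is a closed walk of
  nonpositive weight. Symmetrically, an optimal walk from \<open>c\<close> gains nothing before its last visit.
\<close>

lemma prod_to_loop_bound:
  assumes "mp_prod A k $ u $ c \<noteq> -\<infinity>"
  obtains q where "walk S u q c" "length q \<le> k" "c \<notin> fst ` set q"
    "mp_prod A k $ u $ c \<le> trellis_weight A 0 q"
proof -
  obtain p where p: "walk S u p c" "length p = k" "trellis_weight A 0 p = mp_prod A k $ u $ c"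
    using prod_attained[OF assms] .
  have "c \<in> set (walk_nodes S u p)"
    using p(1) mat_digraph.awlast_of_awalk[of S u p c] last_in_set[of "walk_nodes S u p"] by auto
  then obtain q r where qr: "p = q @ r" "walk S u q c" "walk S c r c" "c \<notin> fst ` set q"
    using mat_digraph.awalk_split_first_visit[OF p(1) \<open>c \<in> _\<close>] by auto
  have "trellis_weight A (length q) r \<le> 0"
    using trellis_weight_le_sup[of "length q" r] closed_walk_weight_le_0[OF qr(3)] qr(1) p(2) by simp
  then have "mp_prod A k $ u $ c \<le> trellis_weight A 0 q"
    unfolding p(3)[symmetric] qr(1) trellis_weight_append
    using add_left_mono[of _ 0 "trellis_weight A 0 q"] by simp
  then show thesis using that[of q] qr p(2) by simp
qed

lemma prod_from_loop_bound:
  assumes "mp_prod A k $ c $ v \<noteq> -\<infinity>"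
  obtains r where "walk S c r v" "length r \<le> k" "c \<notin> snd ` set r"
    "mp_prod A k $ c $ v \<le> trellis_weight A (k - length r) r"
proof -
  obtain p where p: "walk S c p v" "length p = k" "trellis_weight A 0 p = mp_prod A k $ c $ v"
    using prod_attained[OF assms] .
  have "c \<in> set (walk_nodes S c p)"
    using p(1) mat_digraph.hd_in_awalk_verts(1) by blast
  then obtain q r where qr: "p = q @ r" "walk S c q c" "walk S c r v" "c \<notin> snd ` set r"
    using mat_digraph.awalk_split_last_visit[OF p(1) \<open>c \<in> _\<close>] by auto
  have k: "k - length r = length q" using qr(1) p(2) by auto
  have "trellis_weight A 0 q \<le> 0"
    using trellis_weight_le_sup[of 0 q] closed_walk_weight_le_0[OF qr(2)] qr(1) p(2) by simp
  then have "mp_prod A k $ c $ v \<le> trellis_weight A (k - length r) r"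
    unfolding p(3)[symmetric] k qr(1) trellis_weight_append
    using add_right_mono[of _ 0 "trellis_weight A (length q) r"] by simp
  then show thesis using that[of r] qr p(2) by simp
qed

lemma prod_through_loop_le:
  assumes "walk S u p v" "length p = k" "c \<in> set (walk_nodes S u p)"
  shows "trellis_weight A 0 p \<le> mp_prod A k $ u $ c + mp_prod A k $ c $ v"
proof -
  obtain q r where qr: "p = q @ r" "walk S u q c" "walk S c r v"
    using mat_digraph.awalk_decomp[OF assms(1,3)] by blast
  have "trellis_weight A 0 q \<le> mp_prod A k $ u $ c"
    using glue_at_loop[OF qr(2), of "[]" c] qr(1) assms(2) by (simp add: mat_digraph.awalk_simps)
  moreover have "trellis_weight A (length q) r \<le> mp_prod A k $ c $ v"
    using glue_at_loop[OF _ qr(3), of c "[]"] qr(1) assms(2) by (auto simp: mat_digraph.awalk_simps)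
  ultimately show ?thesis
    unfolding qr(1) trellis_weight_append by (auto intro: add_mono)
qed

lemma walk_avoiding_loop_weight_le:
  assumes "walk S u p v" "c \<notin> set (walk_nodes S u p)"
    and "\<mu> < 0" "lambda_star c \<X> \<le> ereal \<mu>"
  shows "\<bar>gamma c \<X> u v\<bar> \<noteq> \<infinity>"
    and "weight S p \<le> gamma c \<X> u v + ereal (\<mu> * (real (length p) - (real CARD('n) - 1)))"
proof -
  have nodes: "set (walk_nodes S u q) = {u} \<union> fst ` set q \<union> snd ` set q" if "walk S u q v" for q
    using mat_digraph.set_awalk_verts[OF that] by simp
  have "c \<notin> fst ` set p"
    using assms(2) nodes[OF assms(1)] by blast
  then obtain p' where p': "simple_path S u p' v" "set p' \<subseteq> set p"
    "weight S p \<le> weight S p' + ereal (\<mu> * (real (length p) - (real CARD('n) - 1)))"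
    using walk_weight_le_path_weight[OF assms(1) _ assms(3,4)] by blast
  have "walk S u p' v"
    using p'(1) by (simp add: pre_digraph.apath_def)
  then have avoid: "c \<notin> set (walk_nodes S u p')"
    using assms(2) p'(2) by (auto simp: nodes assms(1))
  then show "\<bar>gamma c \<X> u v\<bar> \<noteq> \<infinity>"
    by (rule gamma_finite[OF p'(1)])
  have "weight S p' \<le> gamma c \<X> u v"
    unfolding gamma_def using p'(1) avoid by (intro SUP_upper) simp
  then show "weight S p \<le> gamma c \<X> u v + ereal (\<mu> * (real (length p) - (real CARD('n) - 1)))"
    using p'(3) by (meson add_right_mono order_trans)
qed

end

text \<open>
  The two estimates are computations with real numbers, so \<open>w\<^sub>i\<close> and \<open>v\<^sub>j\<close> must be finite.
  If one of them were \<open>-\<infinity>\<close>, then for finite \<open>\<lambda>\<^sup>*\<close> the second quotient would be \<open>\<infinity>\<close>, contrary to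
  the bound on \<open>k\<close>; for \<open>\<lambda>\<^sup>* = -\<infinity>\<close> that bound reads \<open>2 (n - 1) < k\<close>, so that all nodes are within
  reach.
\<close>

lemma (in common_critical_loop_product) prod_eq_through_loop:
  assumes gamma_cond: "gamma_quot c \<X> k i j + ereal (real CARD('n) - 1) < ereal (real k)"
    and alpha_beta_cond:
      "alpha_beta_quot c \<X> k i j + ereal (2 * (real CARD('n) - 1)) < ereal (real k)"
  shows "mp_prod A k $ i $ j = mp_prod A k $ i $ c + mp_prod A k $ c $ j"
proof -
  let ?P = "mp_prod A k" and ?n = "real CARD('n) - 1"
  obtain a where a: "alpha c \<X> i = ereal a" using alpha_finite[of i] by (cases "alpha c \<X> i") auto
  obtain b where b: "beta c \<X> j = ereal b" using beta_finite[of j] by (cases "beta c \<X> j") auto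
  have ub: "w_par c \<X> k i \<noteq> \<infinity>" "v_par c \<X> k j \<noteq> \<infinity>"
    using w_par_le_prod[of i] v_par_le_prod[of j] prod_ne_PInf by (metis ereal_infty_less_eq(1))+
  have lb: "w_par c \<X> k i \<noteq> -\<infinity> \<and> v_par c \<X> k j \<noteq> -\<infinity>"
  proof (cases "lambda_star c \<X> = -\<infinity>")
    case True
    then have "2 * ?n < real k"
      using alpha_beta_cond by (simp add: alpha_beta_quot_def quot_def)
    then have "CARD('n) - 1 \<le> k"
      by (simp add: of_nat_diff)
    then show ?thesis using w_par_ne_MInf v_par_ne_MInf by blast
  next
    case False
    then obtain l where l: "lambda_star c \<X> = ereal l" "l < 0"
      using lambda_star_neg by (cases "lambda_star c \<X>") auto
    show ?thesis
    proof (rule ccontr)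
      assume "\<not> ?thesis"
      then have "w_par c \<X> k i - alpha c \<X> i + v_par c \<X> k j - beta c \<X> j = -\<infinity>"
        using ub a b by (cases "w_par c \<X> k i"; cases "v_par c \<X> k j") auto
      then show False
        using alpha_beta_cond l by (simp add: alpha_beta_quot_def quot_def)
    qed
  qed
  obtain w where w: "w_par c \<X> k i = ereal w" using ub lb by (cases "w_par c \<X> k i") auto
  obtain v where v: "v_par c \<X> k j = ereal v" using ub lb by (cases "v_par c \<X> k j") auto
  obtain x where x: "?P $ i $ c = ereal x" "w \<le> x"
    using w_par_le_prod[of i] prod_ne_PInf[of i c] w by (cases "?P $ i $ c") auto
  obtain y where y: "?P $ c $ j = ereal y" "v \<le> y"
    using v_par_le_prod[of j] prod_ne_PInf[of c j] v by (cases "?P $ c $ j") auto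

  have "?P $ i $ j \<le> ?P $ i $ c + ?P $ c $ j"
  proof (cases "?P $ i $ j = -\<infinity>")
    case False
    then obtain p where p: "walk S i p j" "length p = k" "trellis_weight A 0 p = ?P $ i $ j"
      using prod_attained by blast
    show ?thesis
    proof (cases "c \<in> set (walk_nodes S i p)")
      case True
      then show ?thesis using prod_through_loop_le[OF p(1,2)] p(3) by simp
    next
      case avoid: False
      \<comment> \<open>That \<open>\<gamma>\<close> is finite follows from the reduction of \<open>p\<close> to a path, at any rate \<open>\<mu>0\<close>.\<close>
      obtain \<mu>0 where "\<mu>0 < 0" "lambda_star c \<X> \<le> ereal \<mu>0"
        using lambda_star_neg ereal_dense2[of "lambda_star c \<X>" 0] by (auto intro: less_imp_le)
      then obtain g where g: "gamma c \<X> i j = ereal g"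
        using walk_avoiding_loop_weight_le(1)[OF p(1) avoid] by (cases "gamma c \<X> i j") auto
      have "quot (ereal (w + v - g)) (lambda_star c \<X>) + ereal ?n < ereal (real k)"
        using gamma_cond by (simp add: gamma_quot_def g w v)
      then obtain \<mu> where \<mu>: "\<mu> < 0" "lambda_star c \<X> \<le> ereal \<mu>" "\<mu> * (real k - ?n) < w + v - g"
        using rate_below_quot[OF lambda_star_neg] by blast
      have "?P $ i $ j \<le> weight S p"
        using trellis_weight_le_sup[of 0 p] p by simp
      also have "\<dots> \<le> ereal (g + \<mu> * (real k - ?n))"
        using walk_avoiding_loop_weight_le(2)[OF p(1) avoid \<mu>(1,2)] g p(2) by simp
      also have "\<dots> \<le> ereal (x + y)"
        using \<mu>(3) x(2) y(2) by simp
      finally show ?thesis using x y by simp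
    qed
  qed simp
  moreover have "?P $ i $ c + ?P $ c $ j \<le> ?P $ i $ j"
  proof -
    obtain q where q: "walk S i q c" "length q \<le> k" "c \<notin> fst ` set q"
      "?P $ i $ c \<le> trellis_weight A 0 q"
      using prod_to_loop_bound[of i] x by auto
    obtain r where r: "walk S c r j" "length r \<le> k" "c \<notin> snd ` set r"
      "?P $ c $ j \<le> trellis_weight A (k - length r) r"
      using prod_from_loop_bound[of j] y by auto
    have "quot (ereal (w - a + v - b)) (lambda_star c \<X>) + ereal (2 * ?n) < ereal (real k)"
      using alpha_beta_cond by (simp add: alpha_beta_quot_def a b w v)
    then obtain \<mu> where \<mu>: "\<mu> < 0" "lambda_star c \<X> \<le> ereal \<mu>"
      "\<mu> * (real k - 2 * ?n) < w - a + v - b"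
      using rate_below_quot[OF lambda_star_neg] by blast
    obtain q' where q': "simple_path S i q' c"
      "weight S q \<le> weight S q' + ereal (\<mu> * (real (length q) - ?n))"
      using walk_weight_le_path_weight[OF q(1) _ \<mu>(1,2)] q(3) by blast
    obtain r' where r': "simple_path S c r' j"
      "weight S r \<le> weight S r' + ereal (\<mu> * (real (length r) - ?n))"
      using walk_weight_le_path_weight[OF r(1) _ \<mu>(1,2)] r(3) by blast
    have "weight S q' \<le> ereal a"
      unfolding a[symmetric] alpha_def using q'(1) by (intro SUP_upper) simp
    then have "weight S q' + ereal (\<mu> * (real (length q) - ?n)) \<le>
        ereal (a + \<mu> * (real (length q) - ?n))"
      using add_right_mono[of _ "ereal a" "ereal (\<mu> * (real (length q) - ?n))"] by simp
    moreover have "ereal w \<le> weight S q"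
      using x q(4) trellis_weight_le_sup[of 0 q] q(2) by (metis add_0 ereal_less_eq(3) order_trans)
    ultimately have 1: "w \<le> a + \<mu> * (real (length q) - ?n)"
      using q'(2) by (metis ereal_less_eq(3) order_trans)
    have "weight S r' \<le> ereal b"
      unfolding b[symmetric] beta_def using r'(1) by (intro SUP_upper) simp
    then have "weight S r' + ereal (\<mu> * (real (length r) - ?n)) \<le>
        ereal (b + \<mu> * (real (length r) - ?n))"
      using add_right_mono[of _ "ereal b" "ereal (\<mu> * (real (length r) - ?n))"] by simp
    moreover have "ereal v \<le> weight S r"
      using y r(4) trellis_weight_le_sup[of "k - length r" r] r(2)
      by (metis le_add_diff_inverse2 order_refl ereal_less_eq(3) order_trans)
    ultimately have 2: "v \<le> b + \<mu> * (real (length r) - ?n)"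
      using r'(2) by (metis ereal_less_eq(3) order_trans)
    have "\<mu> * real k < \<mu> * (real (length q) + real (length r))"
      using 1 2 \<mu>(3) by (simp add: algebra_simps)
    then have "length q + length r \<le> k"
      using \<mu>(1) by (simp add: mult_less_cancel_left)
    then have "trellis_weight A 0 q + trellis_weight A (k - length r) r \<le> ?P $ i $ j"
      by (rule glue_at_loop[OF q(1) r(1)])
    then show ?thesis
      using add_mono[OF q(4) r(4)] by (rule order_trans[rotated])
  qed
  ultimately show ?thesis by (rule antisym)
qed

theorem corollary4p3:
  fixes \<X> :: "(ereal^'n::finite^'n) set"
    and c :: 'n
    and A :: "nat \<Rightarrow> ereal^'n^'n"
    and k :: nat
    and i j :: 'n
  assumes "\<X> \<noteq> {}"
    and "\<forall>X\<in>\<X>. rmax_mat X"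
    and "\<forall>X\<in>\<X>. irreducible_mat X"
    and "\<forall>X\<in>\<X>. \<forall>Y\<in>\<X>. geom_equiv X Y"
    and "\<forall>X\<in>\<X>. geom_equiv (mat_inf \<X>) X"
    and "\<forall>X\<in>\<X>. unique_critical_loop c X"
    and "unique_critical_loop c (mat_sup \<X>)"
    and "\<forall>t\<in>{1..k}. A t \<in> \<X>"
    and "ereal (real k) >
           max (gamma_quot c \<X> k i j + ereal (real CARD('n) - 1))
               (alpha_beta_quot c \<X> k i j + ereal (2 * (real CARD('n) - 1)))"
  shows "mp_prod A k $ i $ j = mp_prod A k $ i $ c + mp_prod A k $ c $ j"
proof -
  have "edges X = edges Y" if "X \<in> \<X>" "Y \<in> \<X>" for X Y
    using assms(4) that unfolding geom_equiv_def by blast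
  moreover have "edges (mat_inf \<X>) = edges X" if "X \<in> \<X>" for X
    using assms(5) that unfolding geom_equiv_def by blast
  moreover have "A t \<in> \<X>" if "1 \<le> t" "t \<le> k" for t
    using assms(8) that by simp
  ultimately interpret common_critical_loop_product c \<X> A k
    using assms(1,2,3,6,7) by unfold_locales blast+
  show ?thesis
    using assms(9) by (intro prod_eq_through_loop) simp_all
qed
end
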